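(* Let $1\le p\le\infty$ and let $f\in L_p[0,1]$ be a self-similar function of zero spectral order with parameters $n,a_k,d_k,\beta_k$, let $\hat k$ be the unique index with $d_{\hat k}\neq0$, and suppose that $\hat G_{\hat k}=G_{\hat k}$ (orientation preserving). Let $S(x)=a_{\hat k}x+\alpha_{\hat k}$. Then the intervals $S^m([0,1])$, $m=1,2,\dots$ (where $S^m$ is the $m$-th iterate of $S$), are nested and shrink to the single point $$\hat x=\frac{\alpha_{\hat k}}{1-a_{\hat k}},$$ and at every point $x\in[0,1]$, $x\neq\hat x$, the one-sided limits $f(x+0)$ and $f(x-0)$ (only one of them at an endpoint of $[0,1]$) exist. In particular, $\hat x=1$ if $\hat k=n$, and $\hat x=0$ if $\hat k=1$.
   Context: Similarity operators. Fix an integer $n>1$, real numbers $a_k>0$ ($k=1,\dots,n$) with $\sum_{k=1}^n a_k=1$, and real numbers $d_k,\beta_k$ ($k=1,\dots,n$). Put $\alpha_1=0$ and $\alpha_k=\sum_{l=1}^{k-1}a_l$ for $k=2,\dots,n+1$, so that $0=\alpha_1<\dots<\alpha_{n+1}=1$. For $f\in L_p[0,1]$ and $x\in[\alpha_k,\alpha_{k+1}]$ put $G_k(f)(x)=f\big((x-\alpha_k)/a_k\big)$ (orientation preserving) and $\tilde G_k(f)(x)=f\big((\alpha_{k+1}-x)/a_k\big)$ (orientation reversing); both are regarded as zero outside $[\alpha_k,\alpha_{k+1}]$. For each $k$ let $\hat G_k$ be either $G_k$ or $\tilde G_k$. The similarity operator $G:L_p[0,1]\to L_p[0,1]$ is $$G(f)=\sum_{k=1}^n\left\{\beta_k\,\chi_{(\alpha_k,\alpha_{k+1})}+d_k\,\hat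 G_k(f)\right\},$$ where $\chi$ denotes a characteristic function. Standing assumptions. $G$ is a contraction in $L_p[0,1]$: $\sum_{k=1}^n a_k|d_k|^p<1$ if $1\le p<\infty$, respectively $\max_k|d_k|<1$ if $p=\infty$. At least one of the $\beta_k$ is nonzero. A function $f\in L_p[0,1]$ is self-similar if $G(f)=f$ for such a $G$ (the fixed point is unique). It is called a self-similar function of zero spectral order if exactly one of the numbers $d_1,\dots,d_n$ is nonzero. One-sided limits of $f$ (an element of $L_p[0,1]$) are understood up to null sets: $f(x_0+0)=L$ means that for every neighbourhood $U$ of $L$ there is $\delta>0$ with $f(x)\in U$ for almost every $x\in(x_0,x_0+\delta)$; similarly for $f(x_0-0)$. *)

theory Defs
  imports "HOL-Analysis.Analysis"
begin

text \<open>Elements of L_p are represented by functions; equality in L_p is equality almost everywhere.\<close>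

definition Lp_fun :: "ennreal \<Rightarrow> 'a measure \<Rightarrow> ('a \<Rightarrow> real) set" where
  "Lp_fun p M = {f \<in> borel_measurable M.
     if p = \<infinity> then \<exists>C. AE x in M. \<bar>f x\<bar> \<le> C
     else integrable M (\<lambda>x. \<bar>f x\<bar> powr enn2real p)}"

definition breakpoint :: "(nat \<Rightarrow> real) \<Rightarrow> nat \<Rightarrow> real" where
  "breakpoint a k = (\<Sum>l\<in>{1..<k}. a l)"

datatype orientation = Preserving | Reversing

definition branch :: "(nat \<Rightarrow> real) \<Rightarrow> (nat \<Rightarrow> orientation) \<Rightarrow> nat \<Rightarrow> (real \<Rightarrow> real) \<Rightarrow> real \<Rightarrow> real" where
  "branch a ori k f x =
     (if x \<in> {breakpoint a k..breakpoint a (k + 1)} then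
        (case ori k of
           Preserving \<Rightarrow> f ((x - breakpoint a k) / a k)
         | Reversing \<Rightarrow> f ((breakpoint a (k + 1) - x) / a k))
      else 0)"

definition similarity_op ::
  "nat \<Rightarrow> (nat \<Rightarrow> real) \<Rightarrow> (nat \<Rightarrow> real) \<Rightarrow> (nat \<Rightarrow> real) \<Rightarrow> (nat \<Rightarrow> orientation)
    \<Rightarrow> (real \<Rightarrow> real) \<Rightarrow> real \<Rightarrow> real" where
  "similarity_op n a d \<beta> ori f x =
     (\<Sum>k\<in>{1..n}. \<beta> k * indicator {breakpoint a k<..<breakpoint a (k + 1)} x
                  + d k * branch a ori k f x)"

definition contraction_cond :: "ennreal \<Rightarrow> nat \<Rightarrow> (nat \<Rightarrow> real) \<Rightarrow> (nat \<Rightarrow> real) \<Rightarrow> bool" where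
  "contraction_cond p n a d \<longleftrightarrow>
     (if p = \<infinity> then (MAX k\<in>{1..n}. \<bar>d k\<bar>) < 1
      else (\<Sum>k\<in>{1..n}. a k * \<bar>d k\<bar> powr enn2real p) < 1)"

definition similarity_parameters ::
  "ennreal \<Rightarrow> nat \<Rightarrow> (nat \<Rightarrow> real) \<Rightarrow> (nat \<Rightarrow> real) \<Rightarrow> (nat \<Rightarrow> real) \<Rightarrow> bool" where
  "similarity_parameters p n a d \<beta> \<longleftrightarrow>
     n > 1 \<and> (\<forall>k\<in>{1..n}. a k > 0) \<and> (\<Sum>k\<in>{1..n}. a k) = 1 \<and>
     contraction_cond p n a d \<and> (\<exists>k\<in>{1..n}. \<beta> k \<noteq> 0)"

definition self_similar ::
  "ennreal \<Rightarrow> nat \<Rightarrow> (nat \<Rightarrow> real) \<Rightarrow> (nat \<Rightarrow> real) \<Rightarrow> (nat \<Rightarrow> real) \<Rightarrow> (nat \<Rightarrow> orientation)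
    \<Rightarrow> (real \<Rightarrow> real) \<Rightarrow> bool" where
  "self_similar p n a d \<beta> ori f \<longleftrightarrow>
     similarity_parameters p n a d \<beta> \<and>
     f \<in> Lp_fun p (lebesgue_on {0..1}) \<and>
     (AE x in lebesgue_on {0..1}. similarity_op n a d \<beta> ori f x = f x)"

definition self_similar_zero_order ::
  "ennreal \<Rightarrow> nat \<Rightarrow> (nat \<Rightarrow> real) \<Rightarrow> (nat \<Rightarrow> real) \<Rightarrow> (nat \<Rightarrow> real) \<Rightarrow> (nat \<Rightarrow> orientation)
    \<Rightarrow> (real \<Rightarrow> real) \<Rightarrow> bool" where
  "self_similar_zero_order p n a d \<beta> ori f \<longleftrightarrow>
     self_similar p n a d \<beta> ori f \<and> (\<exists>!k. k \<in> {1..n} \<and> d k \<noteq> 0)"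

text \<open>One-sided limits up to null sets. Since \<open>\<delta>\<close> may be shrunk, the values of \<open>f\<close> outside
  [0,1] are irrelevant for right limits at points of [0,1) and for left limits at points of (0,1].\<close>

definition ess_right_limit :: "(real \<Rightarrow> real) \<Rightarrow> real \<Rightarrow> real \<Rightarrow> bool" where
  "ess_right_limit f x0 L \<longleftrightarrow>
     (\<forall>U. open U \<and> L \<in> U \<longrightarrow>
        (\<exists>\<delta>>0. AE x in lebesgue. x \<in> {x0<..<x0 + \<delta>} \<longrightarrow> f x \<in> U))"

definition ess_left_limit :: "(real \<Rightarrow> real) \<Rightarrow> real \<Rightarrow> real \<Rightarrow> bool" where
  "ess_left_limit f x0 L \<longleftrightarrow>
     (\<forall>U. open U \<and> L \<in> U \<longrightarrow>
        (\<exists>\<delta>>0. AE x in lebesgue. x \<in> {x0 - \<delta><..<x0} \<longrightarrow> f x \<in> U))"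

end

theory Submission
  imports Defs
begin

text \<open>
  On the piece with index \<open>khat\<close> the fixed point equation reads
  \<open>f x = \<beta> khat + d khat * f (S\<^sup>-\<^sup>1 x)\<close>, and on every other piece \<open>f\<close> is almost everywhere the
  constant \<open>\<beta> k\<close>. So a one-sided limit at a point \<open>x\<close> whose one-sided neighbourhood lies in
  another piece exists at once, and otherwise it is inherited from \<open>S\<^sup>-\<^sup>1 x\<close>
  (\<open>ess_side_limit_affine\<close>). The map \<open>S\<^sup>-\<^sup>1\<close> multiplies the distance from \<open>xhat\<close> by
  \<open>1 / a khat > 1\<close>, so the backward orbit of a point other than \<open>xhat\<close> cannot stay in the unit
  interval and meets a piece of constancy after finitely many steps. This is the induction in
  \<open>ex_ess_side_limit\<close>.

  The geometric assertions follow from \<open>S\<^sup>m x = xhat + (a khat)\<^sup>m (x - xhat)\<close> and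
  \<open>xhat \<in> {0..1}\<close>.
\<close>

section \<open>The partition of the unit interval\<close>

lemma breakpoint_Suc:
  assumes "1 \<le> k"
  shows "breakpoint a (k + 1) = breakpoint a k + a k"
  using assms by (simp add: breakpoint_def)

lemma breakpoint_1 [simp]: "breakpoint a 1 = 0" "breakpoint a (Suc 0) = 0"
  by (simp_all add: breakpoint_def)

lemma breakpoint_last: "breakpoint a (n + 1) = (\<Sum>k\<in>{1..n}. a k)"
  by (simp add: breakpoint_def atLeastLessThanSuc_atLeastAtMost)

lemma breakpoint_mono:
  assumes pos: "\<forall>k\<in>{1..n}. a k > 0" and "i \<le> j" "j \<le> n + 1" "1 \<le> i"
  shows "breakpoint a i \<le> breakpoint a j"
  unfolding breakpoint_def
  by (rule sum_mono2) (use assms in \<open>auto simp: less_imp_le\<close>)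

lemma ex_piece_right:
  assumes "0 \<le> x" "x < breakpoint a (n + 1)"
  shows "\<exists>k\<in>{1..n}. breakpoint a k \<le> x \<and> x < breakpoint a (k + 1)"
  using assms(2)
proof (induction n)
  case 0
  then show ?case using assms(1) by simp
next
  case (Suc n)
  then show ?case
    by (cases "x < breakpoint a (n + 1)") force+
qed

lemma ex_piece_left:
  assumes "0 < x" "x \<le> breakpoint a (n + 1)"
  shows "\<exists>k\<in>{1..n}. breakpoint a k < x \<and> x \<le> breakpoint a (k + 1)"
  using assms(2)
proof (induction n)
  case 0
  then show ?case using assms(1) by simp
next
  case (Suc n)
  then show ?case
    by (cases "x \<le> breakpoint a (n + 1)") force+
qed

lemma similarity_op_on_piece:
  assumes pos: "\<forall>k\<in>{1..n}. a k > 0" and k: "k \<in> {1..n}"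
    and x: "breakpoint a k < x" "x < breakpoint a (k + 1)"
  shows "similarity_op n a d \<beta> ori f x = \<beta> k + d k * branch a ori k f x"
proof -
  have out: "x \<notin> {breakpoint a j..breakpoint a (j + 1)}" if j: "j \<in> {1..n}" "j \<noteq> k" for j
  proof (cases "j < k")
    case True
    have "breakpoint a (j + 1) \<le> breakpoint a k"
      by (rule breakpoint_mono[OF pos]) (use True j k in auto)
    then show ?thesis using x by auto
  next
    case False
    have "breakpoint a (k + 1) \<le> breakpoint a j"
      by (rule breakpoint_mono[OF pos]) (use False j k in auto)
    then show ?thesis using x by auto
  qed
  have "similarity_op n a d \<beta> ori f x =
      (\<Sum>j\<in>{1..n}. if j = k then \<beta> k + d k * branch a ori k f x else 0)"
    unfolding similarity_op_def
  proof (rule sum.cong[OF refl])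
    fix j assume j: "j \<in> {1..n}"
    show "\<beta> j * indicator {breakpoint a j<..<breakpoint a (j + 1)} x + d j * branch a ori j f x =
      (if j = k then \<beta> k + d k * branch a ori k f x else 0)"
    proof (cases "j = k")
      case True
      then show ?thesis using x by simp
    next
      case False
      then show ?thesis using out[OF j False] by (auto simp: branch_def indicator_def)
    qed
  qed
  also have "\<dots> = \<beta> k + d k * branch a ori k f x"
    using k by simp
  finally show ?thesis .
qed

section \<open>One-sided essential limits\<close>

lemma AE_lebesgue_affine:
  fixes r b :: real
  assumes "AE y in lebesgue. P y" "r \<noteq> 0"
  shows "AE x in lebesgue. P ((x - b) / r)"
proof -
  obtain N where N: "N \<in> null_sets lebesgue" "{y. \<not> P y} \<subseteq> N"
    using assms(1) by (auto simp: eventually_ae_filter)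
  have "negligible ((\<lambda>y. r * y + b) ` N)"
    by (rule negligible_differentiable_image_negligible)
       (use N in \<open>auto simp: negligible_iff_null_sets intro!: derivative_intros\<close>)
  moreover have "{x. \<not> P ((x - b) / r)} \<subseteq> (\<lambda>y. r * y + b) ` N"
  proof
    fix x assume "x \<in> {x. \<not> P ((x - b) / r)}"
    then have "(x - b) / r \<in> N" using N(2) by auto
    moreover have "x = r * ((x - b) / r) + b" using assms(2) by simp
    ultimately show "x \<in> (\<lambda>y. r * y + b) ` N" by blast
  qed
  ultimately show ?thesis
    by (auto simp: eventually_ae_filter negligible_iff_null_sets)
qed

text \<open>Right and left limits are the cases \<open>s = 1\<close> and \<open>s = -1\<close>; since an increasing affine map
  preserves the side \<open>s\<close>, one argument covers both.\<close>

definition ess_side_limit :: "real \<Rightarrow> (real \<Rightarrow> real) \<Rightarrow> real \<Rightarrow> real \<Rightarrow> bool" where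
  "ess_side_limit s f x0 L \<longleftrightarrow>
     (\<forall>U. open U \<and> L \<in> U \<longrightarrow>
        (\<exists>\<delta>>0. AE x in lebesgue. 0 < s * (x - x0) \<and> s * (x - x0) < \<delta> \<longrightarrow> f x \<in> U))"

lemma ess_right_limit_iff: "ess_right_limit f x L \<longleftrightarrow> ess_side_limit 1 f x L"
  by (simp add: ess_right_limit_def ess_side_limit_def less_diff_eq diff_less_eq add.commute)

lemma ess_left_limit_iff: "ess_left_limit f x L \<longleftrightarrow> ess_side_limit (-1) f x L"
proof -
  have "(y \<in> {x - \<delta><..<x}) = (0 < (-1) * (y - x) \<and> (-1) * (y - x) < \<delta>)" for y \<delta>
    by auto
  then show ?thesis by (simp only: ess_left_limit_def ess_side_limit_def)
qed

lemma ess_side_limit_const: "ess_side_limit s (\<lambda>x. c) x c"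
  unfolding ess_side_limit_def by (auto intro: exI[of _ 1])

lemma ess_side_limit_affine:
  assumes g: "ess_side_limit s g ((x - b) / r) L" and "r > 0" "\<delta> > 0"
    and eq: "AE y in lebesgue. 0 < s * (y - x) \<and> s * (y - x) < \<delta> \<longrightarrow> f y = c + e * g ((y - b) / r)"
  shows "ess_side_limit s f x (c + e * L)"
  unfolding ess_side_limit_def
proof (intro allI impI)
  fix U :: "real set" assume U: "open U \<and> c + e * L \<in> U"
  define V where "V = (\<lambda>t. c + e * t) -` U"
  have "open V"
    unfolding V_def by (rule open_vimage) (use U in \<open>auto intro!: continuous_intros\<close>)
  moreover have "L \<in> V" using U by (simp add: V_def)
  ultimately obtain \<epsilon> where \<epsilon>: "\<epsilon> > 0"
    "AE z in lebesgue. 0 < s * (z - (x - b) / r) \<and> s * (z - (x - b) / r) < \<epsilon> \<longrightarrow> g z \<in> V"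
    using g by (auto simp: ess_side_limit_def)
  have "AE y in lebesgue. 0 < s * ((y - b) / r - (x - b) / r) \<and>
      s * ((y - b) / r - (x - b) / r) < \<epsilon> \<longrightarrow> g ((y - b) / r) \<in> V"
    using AE_lebesgue_affine[OF \<epsilon>(2), of r b] \<open>r > 0\<close> by simp
  moreover have "s * ((y - b) / r - (x - b) / r) = s * (y - x) / r" for y
    by (simp add: diff_divide_distrib[symmetric])
  ultimately have "AE y in lebesgue. 0 < s * (y - x) \<and> s * (y - x) < r * \<epsilon> \<longrightarrow> g ((y - b) / r) \<in> V"
    using \<open>r > 0\<close> by (simp add: zero_less_divide_iff pos_divide_less_eq mult.commute)
  with eq have "AE y in lebesgue. 0 < s * (y - x) \<and> s * (y - x) < min \<delta> (r * \<epsilon>) \<longrightarrow> f y \<in> U"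
    by eventually_elim (auto simp: V_def)
  then show "\<exists>\<delta>>0. AE y in lebesgue. 0 < s * (y - x) \<and> s * (y - x) < \<delta> \<longrightarrow> f y \<in> U"
    using \<open>\<delta> > 0\<close> \<open>r > 0\<close> \<epsilon>(1) by (intro exI[of _ "min \<delta> (r * \<epsilon>)"]) auto
qed

section \<open>Existence of the limits away from the fixed point\<close>

text \<open>The number \<open>\<eta>\<close> expresses that \<open>x\<close> is not the endpoint of the unit interval on side \<open>s\<close>, and
  \<open>\<delta>\<close> expresses the same for the piece found; hence the piece contains a one-sided neighbourhood
  even when \<open>x\<close> is a breakpoint.\<close>

lemma ex_side_piece:
  assumes s: "s = 1 \<or> s = -1" and last: "breakpoint a (n + 1) = 1"
    and x: "0 \<le> x" "x \<le> 1" and \<eta>: "\<eta> > 0" "0 \<le> x + s * \<eta>" "x + s * \<eta> \<le> 1"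
  obtains k \<delta> where "k \<in> {1..n}" "\<delta> > 0" "x \<in> {breakpoint a k..breakpoint a (k + 1)}"
    "x + s * \<delta> \<in> {breakpoint a k..breakpoint a (k + 1)}"
proof (cases "s = 1")
  case True
  then obtain k where "k \<in> {1..n}" "breakpoint a k \<le> x" "x < breakpoint a (k + 1)"
    using ex_piece_right[of x a n] x \<eta> last by auto
  then show ?thesis using True
    by (intro that[of k "breakpoint a (k + 1) - x"]) auto
next
  case False
  then have "s = -1" using s by simp
  then obtain k where "k \<in> {1..n}" "breakpoint a k < x" "x \<le> breakpoint a (k + 1)"
    using ex_piece_left[of x a n] x \<eta> last by auto
  then show ?thesis using \<open>s = -1\<close>
    by (intro that[of k "x - breakpoint a k"]) auto
qed

text \<open>The hypothesis \<open>\<bar>x - c\<bar> > a q ^ m\<close> bounds the number of expanding steps by which \<open>x\<close> can be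
  pulled back inside piece \<open>q\<close>: each step lowers \<open>m\<close> by one, and \<open>m = 0\<close> is absurd because \<open>x\<close>
  and \<open>c\<close> are both in the unit interval.\<close>

lemma ex_ess_side_limit:
  assumes pos: "\<forall>k\<in>{1..n}. a k > 0" and last: "breakpoint a (n + 1) = 1"
    and f: "AE x in lebesgue. x \<in> {0..1} \<longrightarrow> similarity_op n a d \<beta> ori f x = f x"
    and d: "\<And>k. k \<in> {1..n} \<Longrightarrow> k \<noteq> q \<Longrightarrow> d k = 0"
    and ori: "ori q = Preserving"
    and c: "a q * c + breakpoint a q = c" "c \<in> {0..1}"
    and s: "s = 1 \<or> s = -1"
    and "x \<in> {0..1}" "\<eta> > 0" "x + s * \<eta> \<in> {0..1}" "\<bar>x - c\<bar> > a q ^ m"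
  shows "\<exists>L. ess_side_limit s f x L"
  using assms(9-)
proof (induction m arbitrary: x \<eta>)
  case 0
  then show ?case using c by auto
next
  case (Suc m)
  obtain k \<delta> where k: "k \<in> {1..n}" "\<delta> > 0" "x \<in> {breakpoint a k..breakpoint a (k + 1)}"
    "x + s * \<delta> \<in> {breakpoint a k..breakpoint a (k + 1)}"
    using ex_side_piece[OF s last] Suc.prems by (metis atLeastAtMost_iff)
  have step: "breakpoint a (k + 1) = breakpoint a k + a k" "a k > 0"
    using k pos breakpoint_Suc by auto
  have "breakpoint a 1 \<le> breakpoint a k" "breakpoint a (k + 1) \<le> breakpoint a (n + 1)"
    by (rule breakpoint_mono[OF pos]; use k in auto)+
  then have unit: "0 \<le> breakpoint a k" "breakpoint a (k + 1) \<le> 1"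
    using last by auto
  have inside: "breakpoint a k < y \<and> y < breakpoint a (k + 1)"
    if "0 < s * (y - x)" "s * (y - x) < \<delta>" for y
    using s k that by auto
  have on_piece: "AE y in lebesgue. 0 < s * (y - x) \<and> s * (y - x) < \<delta> \<longrightarrow>
      f y = \<beta> k + d k * branch a ori k f y"
    using f
  proof eventually_elim
    case (elim y)
    then show ?case
      using inside[of y] unit similarity_op_on_piece[OF pos k(1), of y d \<beta> ori f] by auto
  qed
  show ?case
  proof (cases "k = q")
    case False
    then have "AE y in lebesgue. 0 < s * (y - x) \<and> s * (y - x) < \<delta> \<longrightarrow>
      f y = \<beta> k + 0 * ((\<lambda>_. 0) ((y - 0) / 1))"
      using on_piece d k(1) by simp
    then show ?thesis
      using ess_side_limit_affine[OF ess_side_limit_const zero_less_one k(2)] by blast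
  next
    case True
    define y where "y = (x - breakpoint a q) / a q"
    have "y \<in> {0..1}" "y + s * (\<delta> / a q) \<in> {0..1}" "\<delta> / a q > 0"
      using k step True by (auto simp: y_def field_simps)
    moreover have "\<bar>y - c\<bar> > a q ^ m"
    proof -
      have "x - c = a q * (y - c)"
      proof -
        have "a q * y = x - breakpoint a q"
          using step True by (simp add: y_def)
        then show ?thesis using c(1) by (simp add: right_diff_distrib)
      qed
      then have "a q * a q ^ m < a q * \<bar>y - c\<bar>"
        using Suc.prems(4) step True by (simp add: abs_mult)
      then show ?thesis using step True by simp
    qed
    ultimately obtain L where "ess_side_limit s f y L"
      using Suc.IH by blast
    moreover have "AE z in lebesgue. 0 < s * (z - x) \<and> s * (z - x) < \<delta> \<longrightarrow>
      f z = \<beta> q + d q * f ((z - breakpoint a q) / a q)"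
      using on_piece
    proof eventually_elim
      case (elim z)
      then show ?case using inside[of z] True ori by (auto simp: branch_def)
    qed
    ultimately show ?thesis
      using ess_side_limit_affine[of s f x "breakpoint a q" "a q" L \<delta> f] k(2) step True
      unfolding y_def by blast
  qed
qed

section \<open>Iterates of a contracting affine map\<close>

lemma funpow_affine:
  fixes r b c :: real
  assumes "r * c + b = c"
  shows "((\<lambda>x. r * x + b) ^^ m) x = c + r ^ m * (x - c)"
proof (induction m)
  case (Suc m)
  have "((\<lambda>x. r * x + b) ^^ Suc m) x = r * (c + r ^ m * (x - c)) + b"
    by (simp add: Suc)
  also have "\<dots> = (r * c + b) + r ^ Suc m * (x - c)"
    by (simp add: algebra_simps)
  finally have "((\<lambda>x. r * x + b) ^^ Suc m) x = (r * c + b) + r ^ Suc m * (x - c)" .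
  then show ?case using assms by simp
qed simp

lemma affine_image_unit_interval:
  fixes c t :: real
  assumes "t > 0"
  shows "(\<lambda>x. c + t * (x - c)) ` {0..1} = {c - t * c..c + t * (1 - c)}"
proof -
  have "(\<lambda>x. c + t * (x - c)) = (\<lambda>x. t * x + (c - t * c))"
    by (auto simp: algebra_simps)
  then have "(\<lambda>x. c + t * (x - c)) ` {0..1} = (\<lambda>x. t * x + (c - t * c)) ` {0..1}"
    by (rule arg_cong)
  also have "\<dots> = {c - t * c..c + t * (1 - c)}"
    using assms by (subst image_affinity_atLeastAtMost) (simp add: algebra_simps)
  finally show ?thesis .
qed

theorem mainTheorem2:
  fixes p :: ennreal and n khat :: nat and a d \<beta> :: "nat \<Rightarrow> real"
    and ori :: "nat \<Rightarrow> orientation" and f S :: "real \<Rightarrow> real" and xhat :: real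
  assumes "1 \<le> p"
    and "self_similar_zero_order p n a d \<beta> ori f"
    and "khat \<in> {1..n}" and "d khat \<noteq> 0"
    and "ori khat = Preserving"
    and "S = (\<lambda>x. a khat * x + breakpoint a khat)"
    and "xhat = breakpoint a khat / (1 - a khat)"
  shows "(\<forall>m\<ge>1. is_interval ((S ^^ m) ` {0..1}) \<and>
                 (S ^^ (m + 1)) ` {0..1} \<subseteq> (S ^^ m) ` {0..1}) \<and>
         (\<Inter>m\<in>{1..}. (S ^^ m) ` {0..1}) = {xhat} \<and>
         (\<lambda>m. diameter ((S ^^ m) ` {0..1})) \<longlonglongrightarrow> 0 \<and>
         (\<forall>x\<in>{0..1}. x \<noteq> xhat \<longrightarrow>
            (x < 1 \<longrightarrow> (\<exists>L. ess_right_limit f x L)) \<and>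
            (x > 0 \<longrightarrow> (\<exists>L. ess_left_limit f x L))) \<and>
         (khat = n \<longrightarrow> xhat = 1) \<and>
         (khat = 1 \<longrightarrow> xhat = 0)"
proof -
  define r b where "r = a khat" and "b = breakpoint a khat"
  have pos: "\<forall>k\<in>{1..n}. a k > 0" and n: "n > 1" and last: "breakpoint a (n + 1) = 1"
    using assms(2)
    by (auto simp: self_similar_zero_order_def self_similar_def similarity_parameters_def
        breakpoint_last[unfolded Suc_eq_plus1[symmetric]])
  have f: "AE x in lebesgue. x \<in> {0..1} \<longrightarrow> similarity_op n a d \<beta> ori f x = f x"
    using assms(2) by (simp add: self_similar_zero_order_def self_similar_def AE_restrict_space_iff)
  have d: "d k = 0" if "k \<in> {1..n}" "k \<noteq> khat" for k
    using assms(2-4) that by (auto simp: self_similar_zero_order_def)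
  have "r > 0" using pos assms(3) by (simp add: r_def)
  have b_r: "breakpoint a (khat + 1) = b + r"
    using assms(3) by (simp add: b_def r_def breakpoint_Suc[unfolded Suc_eq_plus1[symmetric]])
  have "breakpoint a 1 \<le> breakpoint a khat" "breakpoint a (khat + 1) \<le> breakpoint a (n + 1)"
    by (rule breakpoint_mono[OF pos]; use assms(3) in auto)+
  then have "b \<ge> 0" "b + r \<le> 1" using b_r last by (auto simp: b_def)
  \<comment> \<open>As \<open>n > 1\<close>, some other piece takes up part of the total length 1.\<close>
  have "r < 1"
  proof -
    obtain j where j: "j \<in> {1..n}" "j \<noteq> khat"
      using n by (cases "khat = 1") (auto intro: that[of 1] that[of n])
    have "sum a {khat, j} \<le> sum a {1..n}"
      by (rule sum_mono2) (use j assms(3) pos in \<open>auto simp: less_imp_le\<close>)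
    then have "r + a j \<le> 1"
      using j last by (simp add: r_def breakpoint_last[unfolded Suc_eq_plus1] del: One_nat_def)
    then show ?thesis using pos j by fastforce
  qed
  have fix_pt: "r * xhat + b = xhat"
    using \<open>r < 1\<close> assms(7) by (simp add: r_def b_def field_simps)
  have xhat: "xhat \<in> {0..1}"
    using \<open>r < 1\<close> \<open>b \<ge> 0\<close> \<open>b + r \<le> 1\<close> assms(7) by (simp add: r_def b_def)
  have S: "S = (\<lambda>x. r * x + b)" using assms(6) by (simp add: r_def b_def)
  have "(S ^^ m) = (\<lambda>x. xhat + r ^ m * (x - xhat))" for m
    unfolding S by (rule ext) (rule funpow_affine[OF fix_pt])
  then have img: "(S ^^ m) ` {0..1} = {xhat - r ^ m * xhat..xhat + r ^ m * (1 - xhat)}" for m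
    using affine_image_unit_interval[of "r ^ m" xhat] \<open>r > 0\<close> by simp
  have r_lim: "(\<lambda>m. r ^ m) \<longlonglongrightarrow> 0"
    using \<open>r > 0\<close> \<open>r < 1\<close> by (intro LIMSEQ_power_zero) simp
  have small: "\<exists>m\<ge>1. r ^ m < \<epsilon>" if "\<epsilon> > 0" for \<epsilon>
    using order_tendstoD(2)[OF r_lim that]
    by (auto simp: eventually_sequentially) (meson le_cases)
  have nested: "is_interval ((S ^^ m) ` {0..1}) \<and> (S ^^ (m + 1)) ` {0..1} \<subseteq> (S ^^ m) ` {0..1}" for m
  proof -
    have "r ^ (m + 1) \<le> r ^ m"
      using \<open>r > 0\<close> \<open>r < 1\<close> by (intro power_decreasing) auto
    then have "r ^ (m + 1) * xhat \<le> r ^ m * xhat" "r ^ (m + 1) * (1 - xhat) \<le> r ^ m * (1 - xhat)"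
      using xhat by (auto intro!: mult_right_mono simp del: power_Suc)
    then show ?thesis by (simp only: img) (simp add: is_interval_cc)
  qed
  have inter: "(\<Inter>m\<in>{1..}. (S ^^ m) ` {0..1}) = {xhat}"
  proof (intro equalityI subsetI)
    fix y assume y: "y \<in> (\<Inter>m\<in>{1..}. (S ^^ m) ` {0..1})"
    have "\<bar>y - xhat\<bar> \<le> r ^ m" if "m \<ge> 1" for m
    proof -
      have "r ^ m * xhat \<le> r ^ m * 1" "r ^ m * (1 - xhat) \<le> r ^ m * 1"
        using xhat \<open>r > 0\<close> by (auto intro!: mult_left_mono)
      moreover have "y \<in> {xhat - r ^ m * xhat..xhat + r ^ m * (1 - xhat)}"
        using y that img[of m] by blast
      ultimately show ?thesis by (simp add: abs_le_iff)
    qed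
    then have "\<not> \<bar>y - xhat\<bar> > 0" using small by (meson not_le)
    then show "y \<in> {xhat}" by simp
  next
    fix y assume "y \<in> {xhat}"
    then show "y \<in> (\<Inter>m\<in>{1..}. (S ^^ m) ` {0..1})"
      using xhat \<open>r > 0\<close> by (auto simp: img)
  qed
  have "diameter ((S ^^ m) ` {0..1}) = r ^ m" for m
  proof -
    have "(xhat + r ^ m * (1 - xhat)) - (xhat - r ^ m * xhat) = r ^ m"
      by (simp add: algebra_simps)
    moreover have "0 < r ^ m"
      using \<open>r > 0\<close> by simp
    ultimately show ?thesis
      unfolding img diameter_closed_interval by argo
  qed
  then have diam: "(\<lambda>m. diameter ((S ^^ m) ` {0..1})) \<longlonglongrightarrow> 0"
    using r_lim by simp
  have lims: "\<exists>L. ess_side_limit s f x L"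
    if x: "x \<in> {0..1}" "x \<noteq> xhat" and "s = 1 \<or> s = -1" "\<eta> > 0" "x + s * \<eta> \<in> {0..1}" for x s \<eta>
  proof -
    obtain m where "r ^ m < \<bar>x - xhat\<bar>" using small[of "\<bar>x - xhat\<bar>"] x by auto
    moreover have "a khat * xhat + breakpoint a khat = xhat"
      using fix_pt by (simp add: r_def b_def)
    ultimately show ?thesis
      using ex_ess_side_limit[where q = khat and c = xhat, OF pos last f] that d assms(5) xhat r_def
      by blast
  qed
  have right: "\<exists>L. ess_right_limit f x L" if "x \<in> {0..1}" "x \<noteq> xhat" "x < 1" for x
    using lims[of x 1 "1 - x"] that by (simp add: ess_right_limit_iff)
  have left: "\<exists>L. ess_left_limit f x L" if "x \<in> {0..1}" "x \<noteq> xhat" "x > 0" for x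
    using lims[of x "-1" x] that by (simp add: ess_left_limit_iff)
  have "xhat = 1" if "khat = n"
    using that b_r last \<open>r < 1\<close> assms(7) by (simp add: r_def b_def)
  moreover have "xhat = 0" if "khat = 1"
    using that assms(7) by simp
  ultimately show ?thesis using nested inter diam right left by (intro conjI ballI allI impI) auto
qed

end
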